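(* Consider the semi-discrete scheme $$\frac{d}{dt}v_j(t)+\frac{f_{j+\frac12}-f_{j-\frac12}}{\delta x}=0,\qquad j\in\mathbb{Z},\qquad(\mathrm{H})$$ which is a semi-discretization of the first order system $\partial_tv+\partial_xf(v)=0$, and suppose that it is entropy stable: there exists a numerical flux $\mathcal{G}_{0,j+\frac12}$ consistent with $G_0$ such that $$\frac{d}{dt}U(v_j(t))+\frac{\mathcal{G}_{0,j+\frac12}-\mathcal{G}_{0,j-\frac12}}{\delta x}\le0 .$$ Then the difference scheme $$\frac{d}{dt}v_j(t)+\frac{f_{j+\frac12}-f_{j-\frac12}}{\delta x}=\frac{1}{\delta x^2}\Big(B(\rho_{j+\frac12})(z_{j+1}-z_j)-B(\rho_{j-\frac12})(z_j-z_{j-1})\Big),\qquad j\in\mathbb{Z},\qquad(\mathrm{EK})$$ is entropy stable: there exists a numerical flux $\mathcal{G}_{j+\frac12}$, consistent with the full flux $G$, such that $$\frac{d}{dt}U(v_j(t))+\frac{\mathcal{G}_{j+\frac12}-\mathcal{G}_{j-\frac12}}{\delta x}\le0 .$$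
   Context: Let $P$ be a smooth pressure with $P'(\rho)>0$ for $\rho>0$, $F$ a smooth function with $\rho F'(\rho)-F(\rho)=P(\rho)$, $\kappa(\rho)>0$ a smooth capillary coefficient, and $\mu(\rho)=\rho^{3/2}\sqrt{\kappa(\rho)}$. The extended Euler–Korteweg system, obtained with the extra unknown $w=\sqrt{\kappa(\rho)}\,\partial_x\rho/\sqrt{\rho}$, is $$\partial_tv+\partial_xf(v)=\partial_x\big(B(\rho)\partial_xz\big),\qquad v=(\rho,\rho u,\rho w)^T,\quad \rho>0,$$ with $$f(v)=(\rho u,\ \rho u^2+P(\rho),\ \rho uw)^T,\qquad B(\rho)=\begin{pmatrix}0&0&0\\0&0&\mu(\rho)\\0&-\mu(\rho)&0\end{pmatrix},$$ $$U(v)=\rho\frac{u^2+w^2}{2}+F(\rho),\qquad z=\nabla_vU(v)$$ (the second and third components of $z$ are $u$ and $w$). The first order part ($B=0$) has the entropy–entropy flux pair $(U,G_0)$ with $G_0(v)=u(U(v)+P(\rho))$. The full system has the conservation law $\partial_tU(v)+\partial_xG(v,\partial_xu,\partial_xw)=0$ with $$G(v,\partial_xu,\partial_xw)=G_0(v)-\mu(\rho)\,(u\,\partial_xw-w\,\partial_xu).$$ Discrete notation: $\delta x>0$; $v_j=(\rho_j,\rho_ju_j,\rho_jw_j)^T$ with $\rho_j>0$; $z_j=\nabla_vU(v_j)$. The numerical flux $f_{j+\frac12}$ is a given continuous function of finitely many neighbouring states $v_k$, the same function in (H) and in (EK). The interface value $\rho_{j+\frac12}>0$ is a given continuous function of neighbouring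 densities, equal to $\rho$ when these all equal $\rho$. In the entropy inequalities, $\frac{d}{dt}U(v_j)=\nabla_vU(v_j)^T\frac{dv_j}{dt}$ with $\frac{dv_j}{dt}$ given by the scheme under consideration. The inequality is required for all $j$ and all states $(v_k)_k$ with $\rho_k>0$. Consistency of $\mathcal{G}_{0,j+\frac12}$ with $G_0$: it is a continuous function of finitely many neighbouring states which equals $G_0(v)$ when all of them equal $v$. Consistency of $\mathcal{G}_{j+\frac12}$ with $G$: it is a function of finitely many neighbouring states and of $\delta x$ such that, when evaluated at the grid values $v_k=v(x+(k-j)\delta x)$ of a smooth function $v$, it tends to $G(v,\partial_xu,\partial_xw)(x)$ as $\delta x\to0$. *)

theory Defs
  imports "HOL-Analysis.Analysis"
begin

text \<open>A state is the vector \<open>v = (\<rho>, \<rho> u, \<rho> w)\<close>; \<open>vel_u\<close> and \<open>vel_w\<close> recover \<open>u\<close> and \<open>w\<close>.\<close>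

type_synonym state = "real ^ 3"

definition density :: "state \<Rightarrow> real" where
  "density v = v $ 1"

definition vel_u :: "state \<Rightarrow> real" where
  "vel_u v = v $ 2 / v $ 1"

definition vel_w :: "state \<Rightarrow> real" where
  "vel_w v = v $ 3 / v $ 1"

text \<open>Infinite differentiability. Only used for open \<open>S\<close>, where the unrestricted derivative
  \<^const>\<open>deriv\<close> depends only on the values of the function in \<open>S\<close>.\<close>

definition smooth_on :: "real set \<Rightarrow> (real \<Rightarrow> real) \<Rightarrow> bool" where
  "smooth_on S f \<longleftrightarrow> (\<forall>n. (deriv ^^ n) f differentiable_on S)"

definition gradient :: "(state \<Rightarrow> real) \<Rightarrow> state \<Rightarrow> state" where
  "gradient f v = (THE D. GDERIV f v :> D)"


definition mu :: "(real \<Rightarrow> real) \<Rightarrow> real \<Rightarrow> real" where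
  "mu \<kappa> \<rho> = \<rho> powr (3/2) * sqrt (\<kappa> \<rho>)"

definition flux :: "(real \<Rightarrow> real) \<Rightarrow> state \<Rightarrow> state" where
  "flux P v = vector [density v * vel_u v,
                      density v * (vel_u v)\<^sup>2 + P (density v),
                      density v * vel_u v * vel_w v]"

definition Bmat :: "(real \<Rightarrow> real) \<Rightarrow> real \<Rightarrow> real ^ 3 ^ 3" where
  "Bmat \<kappa> \<rho> = vector [vector [0, 0, 0],
                        vector [0, 0, mu \<kappa> \<rho>],
                        vector [0, - mu \<kappa> \<rho>, 0]]"

definition entropy :: "(real \<Rightarrow> real) \<Rightarrow> state \<Rightarrow> real" where
  "entropy F v = density v * (((vel_u v)\<^sup>2 + (vel_w v)\<^sup>2) / 2) + F (density v)"

definition entropy_var :: "(real \<Rightarrow> real) \<Rightarrow> state \<Rightarrow> state" where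
  "entropy_var F = gradient (entropy F)"

definition entropy_flux0 :: "(real \<Rightarrow> real) \<Rightarrow> (real \<Rightarrow> real) \<Rightarrow> state \<Rightarrow> real" where
  "entropy_flux0 P F v = vel_u v * (entropy F v + P (density v))"

definition entropy_flux ::
  "(real \<Rightarrow> real) \<Rightarrow> (real \<Rightarrow> real) \<Rightarrow> (real \<Rightarrow> real) \<Rightarrow> state \<Rightarrow> real \<Rightarrow> real \<Rightarrow> real" where
  "entropy_flux P F \<kappa> v ux wx =
     entropy_flux0 P F v - mu \<kappa> (density v) * (vel_u v * wx - vel_w v * ux)"


text \<open>Grid functions are indexed by \<open>\<int>\<close>. A quantity attached to the interface \<open>j + 1/2\<close> is
  given by a function \<open>\<Phi>\<close> of a grid function, evaluated at the grid function recentred at \<open>j\<close>, so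
  that its arguments \<open>\<dots>, V (-1), V 0, V 1, V 2, \<dots>\<close> are \<open>\<dots>, v\<^sub>j\<^sub>-\<^sub>1, v\<^sub>j, v\<^sub>j\<^sub>+\<^sub>1, v\<^sub>j\<^sub>+\<^sub>2, \<dots>\<close>.\<close>

definition recentre :: "int \<Rightarrow> (int \<Rightarrow> 'a) \<Rightarrow> int \<Rightarrow> 'a" where
  "recentre j V = (\<lambda>k. V (j + k))"

definition admissible :: "(int \<Rightarrow> state) set" where
  "admissible = {V. \<forall>k. density (V k) > 0}"

definition finite_stencil :: "(int \<Rightarrow> 'a) set \<Rightarrow> ((int \<Rightarrow> 'a) \<Rightarrow> 'b) \<Rightarrow> bool" where
  "finite_stencil A \<Phi> \<longleftrightarrow>
     (\<exists>S. finite S \<and> (\<forall>V\<in>A. \<forall>W\<in>A. (\<forall>k\<in>S. V k = W k) \<longrightarrow> \<Phi> V = \<Phi> W))"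

text \<open>Continuity is with respect to the product topology on grid functions; for a function with
  a finite stencil this is continuity in the finitely many values it depends on.\<close>

definition consistent_state_flux ::
  "(state \<Rightarrow> 'b::topological_space) \<Rightarrow> ((int \<Rightarrow> state) \<Rightarrow> 'b) \<Rightarrow> bool" where
  "consistent_state_flux g \<Phi> \<longleftrightarrow>
     finite_stencil admissible \<Phi> \<and> continuous_on admissible \<Phi> \<and>
     (\<forall>v. density v > 0 \<longrightarrow> \<Phi> (\<lambda>_. v) = g v)"

definition interface_density :: "((int \<Rightarrow> real) \<Rightarrow> real) \<Rightarrow> bool" where
  "interface_density r \<longleftrightarrow>
     finite_stencil {R. \<forall>k. R k > 0} r \<and> continuous_on {R. \<forall>k. R k > 0} r \<and>
     (\<forall>R. (\<forall>k. R k > 0) \<longrightarrow> r R > 0) \<and>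
     (\<forall>\<rho>>0. r (\<lambda>_. \<rho>) = \<rho>)"

text \<open>Consistency of a flux that may also depend on the mesh size (its first argument) with a
  flux depending on the state and on the derivatives of \<open>u\<close> and \<open>w\<close>. The finite stencil
  does not depend on the mesh size.\<close>

definition consistent_full_flux ::
  "(state \<Rightarrow> real \<Rightarrow> real \<Rightarrow> real) \<Rightarrow> (real \<Rightarrow> (int \<Rightarrow> state) \<Rightarrow> real) \<Rightarrow> bool" where
  "consistent_full_flux g \<Phi> \<longleftrightarrow>
     (\<exists>S. finite S \<and> (\<forall>\<delta>x>0. \<forall>V\<in>admissible. \<forall>W\<in>admissible.
        (\<forall>k\<in>S. V k = W k) \<longrightarrow> \<Phi> \<delta>x V = \<Phi> \<delta>x W)) \<and>
     (\<forall>v :: real \<Rightarrow> state. (\<forall>i. smooth_on UNIV (\<lambda>x. v x $ i)) \<and> (\<forall>x. density (v x) > 0) \<longrightarrow>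
        (\<forall>x. ((\<lambda>\<delta>x. \<Phi> \<delta>x (\<lambda>k. v (x + of_int k * \<delta>x)))
               \<longlongrightarrow> g (v x) (deriv (\<lambda>y. vel_u (v y)) x) (deriv (\<lambda>y. vel_w (v y)) x))
              (at_right 0)))"


text \<open>The value of \<open>dv\<^sub>j/dt\<close> prescribed by the schemes without and with the
  capillary term at the grid function \<open>V\<close>.\<close>

definition rhs_H :: "((int \<Rightarrow> state) \<Rightarrow> state) \<Rightarrow> real \<Rightarrow> (int \<Rightarrow> state) \<Rightarrow> int \<Rightarrow> state" where
  "rhs_H fnum \<delta>x V j = - ((1 / \<delta>x) *\<^sub>R (fnum (recentre j V) - fnum (recentre (j - 1) V)))"

definition rhs_EK ::
  "(real \<Rightarrow> real) \<Rightarrow> (real \<Rightarrow> real) \<Rightarrow> ((int \<Rightarrow> real) \<Rightarrow> real) \<Rightarrow> ((int \<Rightarrow> state) \<Rightarrow> state) \<Rightarrow>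
   real \<Rightarrow> (int \<Rightarrow> state) \<Rightarrow> int \<Rightarrow> state" where
  "rhs_EK F \<kappa> r fnum \<delta>x V j =
     (let \<rho>half = (\<lambda>i. r (recentre i (\<lambda>k. density (V k))));
          z = (\<lambda>i. entropy_var F (V i))
      in - ((1 / \<delta>x) *\<^sub>R (fnum (recentre j V) - fnum (recentre (j - 1) V)))
         + (1 / \<delta>x\<^sup>2) *\<^sub>R (Bmat \<kappa> (\<rho>half j) *v (z (j + 1) - z j)
                          - Bmat \<kappa> (\<rho>half (j - 1)) *v (z j - z (j - 1))))"

text \<open>The semi-discrete entropy inequality for the scheme \<open>dv\<^sub>j/dt = rhs \<delta>x V j\<close> and the numerical
  entropy flux \<open>\<G>\<close>, with the time derivative of the entropy expanded by the chain rule.\<close>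

definition entropy_inequality ::
  "(real \<Rightarrow> real) \<Rightarrow> (real \<Rightarrow> (int \<Rightarrow> state) \<Rightarrow> int \<Rightarrow> state) \<Rightarrow>
   (real \<Rightarrow> (int \<Rightarrow> state) \<Rightarrow> real) \<Rightarrow> bool" where
  "entropy_inequality F rhs \<G> \<longleftrightarrow>
     (\<forall>\<delta>x>0. \<forall>V\<in>admissible. \<forall>j.
        gradient (entropy F) (V j) \<bullet> rhs \<delta>x V j
        + (\<G> \<delta>x (recentre j V) - \<G> \<delta>x (recentre (j - 1) V)) / \<delta>x \<le> 0)"

end

theory Submission
  imports Defs
begin

text \<open>Since \<open>B\<close> is skew-symmetric, the capillary term tested against \<open>z\<^sub>j\<close> telescopes exactly:
  \<open>z\<^sub>j \<bullet> (B\<^sub>+ (z\<^sub>j\<^sub>+\<^sub>1 - z\<^sub>j) - B\<^sub>- (z\<^sub>j - z\<^sub>j\<^sub>-\<^sub>1)) = z\<^sub>j \<bullet> B\<^sub>+ z\<^sub>j\<^sub>+\<^sub>1 - z\<^sub>j\<^sub>-\<^sub>1 \<bullet> B\<^sub>- z\<^sub>j\<close>.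
  Hence subtracting \<open>z\<^sub>j \<bullet> B\<^sub>+ z\<^sub>j\<^sub>+\<^sub>1 / \<delta>x\<close> from the numerical entropy flux of the first order
  scheme does not change the entropy production. As
  \<open>z\<^sub>j \<bullet> B\<^sub>+ z\<^sub>j\<^sub>+\<^sub>1 = \<mu>\<^sub>+ (u\<^sub>j (w\<^sub>j\<^sub>+\<^sub>1 - w\<^sub>j) - w\<^sub>j (u\<^sub>j\<^sub>+\<^sub>1 - u\<^sub>j))\<close>, the correction is consistent with
  \<open>\<mu> (u \<partial>\<^sub>x w - w \<partial>\<^sub>x u)\<close>.\<close>

lemma smooth_on_imp_differentiable:
  assumes "smooth_on S f" "open S" "x \<in> S"
  shows "f differentiable (at x)"
proof -
  have "(deriv ^^ 0) f differentiable_on S"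
    using assms(1) unfolding smooth_on_def by blast
  then show ?thesis
    using assms(2,3) by (simp add: differentiable_on_eq_differentiable_at)
qed

text \<open>The definite description needs uniqueness: the Frechet derivative at a point is unique,
  and a vector is determined by its inner products with all \<open>h\<close>.\<close>

lemma gradient_eqI:
  assumes "GDERIV f v :> D"
  shows "gradient f v = D"
  unfolding gradient_def
proof (rule the_equality)
  show "GDERIV f v :> D" by (fact assms)
next
  fix E assume "GDERIV f v :> E"
  with assms have "(\<lambda>h. h \<bullet> E) = (\<lambda>h. h \<bullet> D)"
    unfolding gderiv_def by (rule has_derivative_unique[rotated])
  then show "E = D"
    by (metis inner_commute vector_eq_ldot)
qed

text \<open>In conservative variables the kinetic part is
  \<open>((v $ 2)^2 + (v $ 3)^2) / (2 * v $ 1)\<close>; differentiating its denominator yields the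
  negative term in the first component.\<close>

lemma GDERIV_entropy:
  assumes "F differentiable (at (density v))" "density v > 0"
  shows "GDERIV (entropy F) v :>
    vector [deriv F (density v) - ((vel_u v)\<^sup>2 + (vel_w v)\<^sup>2) / 2, vel_u v, vel_w v]"
proof -
  have pos: "v $ 1 > 0" using assms(2) by (simp add: density_def)
  have nth: "((\<lambda>v :: state. v $ i) has_derivative (\<lambda>h. h $ i)) (at v)" for i
    by (rule bounded_linear_imp_has_derivative[OF bounded_linear_vec_nth])
  have "(F has_derivative (*) (deriv F (v $ 1))) (at (v $ 1))"
    using assms(1) unfolding density_def
    by (simp add: DERIV_deriv_iff_real_differentiable flip: has_field_derivative_def)
  then have F: "((\<lambda>v :: state. F (v $ 1)) has_derivative (\<lambda>h. deriv F (v $ 1) * h $ 1)) (at v)"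
    by (rule has_derivative_compose[OF nth])
  \<comment> \<open>The identity is global: where \<open>v $ 1 = 0\<close>, division by zero gives 0
    and both sides are \<open>F 0\<close>. It can therefore be unfolded as an equation of
    functions.\<close>
  have entropy_eq: "entropy F = (\<lambda>v. ((v $ 2)\<^sup>2 + (v $ 3)\<^sup>2) / (2 * v $ 1) + F (v $ 1))"
  proof
    fix v :: state
    show "entropy F v = ((v $ 2)\<^sup>2 + (v $ 3)\<^sup>2) / (2 * v $ 1) + F (v $ 1)"
      by (cases "v $ 1 = 0")
        (simp_all add: entropy_def density_def vel_u_def vel_w_def field_simps power2_eq_square)
  qed
  have square: "((\<lambda>v :: state. (v $ i)\<^sup>2) has_derivative (\<lambda>h. 2 * v $ i * h $ i)) (at v)" for i
    using has_derivative_power[OF nth, of i 2] by (simp add: mult_ac)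
  have "(entropy F has_derivative (\<lambda>h.
      ((2 * v $ 2 * h $ 2 + 2 * v $ 3 * h $ 3) * (2 * v $ 1)
        - ((v $ 2)\<^sup>2 + (v $ 3)\<^sup>2) * (2 * h $ 1)) / (2 * v $ 1 * (2 * v $ 1))
      + deriv F (v $ 1) * h $ 1)) (at v)"
    unfolding entropy_eq
    using pos by (intro has_derivative_add has_derivative_divide' has_derivative_mult_right
        square nth F) simp
  moreover have "((2 * v $ 2 * h $ 2 + 2 * v $ 3 * h $ 3) * (2 * v $ 1)
        - ((v $ 2)\<^sup>2 + (v $ 3)\<^sup>2) * (2 * h $ 1)) / (2 * v $ 1 * (2 * v $ 1))
      + deriv F (v $ 1) * h $ 1
    = h \<bullet> vector [deriv F (density v) - ((vel_u v)\<^sup>2 + (vel_w v)\<^sup>2) / 2, vel_u v, vel_w v]" for h :: state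
    using pos
    by (simp add: inner_vec_def sum_3 density_def vel_u_def vel_w_def field_simps power2_eq_square)
  ultimately show ?thesis
    unfolding gderiv_def by simp
qed

lemma entropy_var_components:
  assumes "F differentiable (at (density v))" "density v > 0"
  shows "entropy_var F v $ 2 = vel_u v" "entropy_var F v $ 3 = vel_w v"
  unfolding entropy_var_def gradient_eqI[OF GDERIV_entropy[OF assms]] by simp_all

text \<open>The form is alternating in \<open>a\<close> and \<open>b\<close>: it vanishes for
  \<open>a = b\<close> and changes sign when they are swapped. Both facts drive the
  telescoping.\<close>

lemma inner_Bmat:
  "a \<bullet> (Bmat \<kappa> \<rho> *v b) = mu \<kappa> \<rho> * (a $ 2 * b $ 3 - a $ 3 * b $ 2)"
  by (simp add: inner_vec_def matrix_vector_mult_def sum_3 Bmat_def algebra_simps)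

lemma isCont_mu:
  assumes "isCont \<kappa> \<rho>" "\<rho> > 0"
  shows "isCont (mu \<kappa>) \<rho>"
  unfolding mu_def [abs_def] using assms by (intro continuous_intros) auto

text \<open>Each sample depends continuously on \<open>h\<close>, so the whole grid function does in
  the product topology. Negative \<open>h\<close> is allowed, which makes 0 an interior
  point.\<close>

lemma continuous_on_grid_sampling:
  fixes f :: "real \<Rightarrow> 'a::topological_space" and \<Phi> :: "(int \<Rightarrow> 'a) \<Rightarrow> 'b::topological_space"
  assumes "continuous_on A \<Phi>" "continuous_on UNIV f"
    and "\<And>h. (\<lambda>k. f (x + of_int k * h)) \<in> A"
  shows "continuous_on UNIV (\<lambda>h. \<Phi> (\<lambda>k. f (x + of_int k * h)))"
proof (rule continuous_on_compose2[OF assms(1)])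
  show "continuous_on UNIV (\<lambda>h k. f (x + of_int k * h))"
    by (intro continuous_on_coordinatewise_then_product continuous_on_compose2[OF assms(2)]
        continuous_intros) auto
qed (use assms(3) in auto)

lemma grid_sampling_tendsto:
  fixes f :: "real \<Rightarrow> 'a::topological_space" and \<Phi> :: "(int \<Rightarrow> 'a) \<Rightarrow> 'b::topological_space"
  assumes "continuous_on A \<Phi>" "continuous_on UNIV f"
    and "\<And>h. (\<lambda>k. f (x + of_int k * h)) \<in> A"
  shows "((\<lambda>h. \<Phi> (\<lambda>k. f (x + of_int k * h))) \<longlongrightarrow> \<Phi> (\<lambda>_. f x)) (at_right 0)"
proof -
  \<comment> \<open>At \<open>h = 0\<close> all samples collapse to \<open>f x\<close>, so
    continuity there identifies the limit.\<close>
  have "isCont (\<lambda>h. \<Phi> (\<lambda>k. f (x + of_int k * h))) 0"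
    using continuous_on_grid_sampling[OF assms] by (simp add: continuous_on_eq_continuous_at)
  then show ?thesis
    unfolding isCont_def by (simp add: filterlim_at_split)
qed

lemma difference_quotient_tendsto_deriv:
  fixes f :: "real \<Rightarrow> real"
  assumes "f differentiable (at x)"
  shows "((\<lambda>h. (f (x + h) - f x) / h) \<longlongrightarrow> deriv f x) (at_right 0)"
  using assms
  by (simp add: DERIV_deriv_iff_real_differentiable[symmetric] DERIV_def filterlim_at_split)

text \<open>This is \<open>z_0 \<bullet> B z_1\<close> in the form of \<open>inner_Bmat\<close>,
  without the factor \<open>1 / \<delta>x\<close>; after recentring, indices 0 and 1 are the two
  cells next to the interface.\<close>

definition capillary_flux ::
  "(real \<Rightarrow> real) \<Rightarrow> ((int \<Rightarrow> real) \<Rightarrow> real) \<Rightarrow> (int \<Rightarrow> state) \<Rightarrow> real" where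
  "capillary_flux \<kappa> r V = mu \<kappa> (r (\<lambda>k. density (V k))) *
     (vel_u (V 0) * vel_w (V 1) - vel_w (V 0) * vel_u (V 1))"

lemma capillary_flux_tendsto:
  assumes r: "interface_density r"
    and \<kappa>: "smooth_on {0<..} \<kappa>"
    and v: "\<And>i. smooth_on UNIV (\<lambda>x. v x $ i)" "\<And>x. density (v x) > 0"
  shows "((\<lambda>h. capillary_flux \<kappa> r (\<lambda>k. v (x + of_int k * h)) / h) \<longlongrightarrow>
      mu \<kappa> (density (v x)) * (vel_u (v x) * deriv (\<lambda>y. vel_w (v y)) x
        - vel_w (v x) * deriv (\<lambda>y. vel_u (v y)) x)) (at_right 0)"
proof -
  have diff: "(\<lambda>y. v y $ i) differentiable (at y)" for i y
    using smooth_on_imp_differentiable[OF v(1)] by simp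
  have nz: "v y $ 1 \<noteq> 0" for y
    using v(2)[of y] by (simp add: density_def)
  have u: "(\<lambda>y. vel_u (v y)) differentiable (at x)" and w: "(\<lambda>y. vel_w (v y)) differentiable (at x)"
    unfolding vel_u_def vel_w_def using diff nz by (auto intro!: derivative_intros)
  have cont: "continuous_on UNIV (\<lambda>y. density (v y))"
    unfolding density_def
    using diff by (simp add: continuous_on_eq_continuous_at differentiable_imp_continuous_within)
  have "((\<lambda>h. r (\<lambda>k. density (v (x + of_int k * h)))) \<longlongrightarrow> r (\<lambda>_. density (v x))) (at_right 0)"
    using r v(2) unfolding interface_density_def
    by (intro grid_sampling_tendsto[OF _ cont, where A = "{R. \<forall>k. R k > 0}"]) auto
  then have "((\<lambda>h. r (\<lambda>k. density (v (x + of_int k * h)))) \<longlongrightarrow> density (v x)) (at_right 0)"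
    using r v(2) unfolding interface_density_def by simp
  moreover have "isCont (mu \<kappa>) (density (v x))"
    using smooth_on_imp_differentiable[OF \<kappa>] v(2)
    by (intro isCont_mu differentiable_imp_continuous_within) auto
  ultimately have "((\<lambda>h. mu \<kappa> (r (\<lambda>k. density (v (x + of_int k * h))))) \<longlongrightarrow> mu \<kappa> (density (v x)))
      (at_right 0)"
    by (rule isCont_tendsto_compose[rotated])
  then have "((\<lambda>h. mu \<kappa> (r (\<lambda>k. density (v (x + of_int k * h)))) *
      (vel_u (v x) * ((vel_w (v (x + h)) - vel_w (v x)) / h)
        - vel_w (v x) * ((vel_u (v (x + h)) - vel_u (v x)) / h))) \<longlongrightarrow>
      mu \<kappa> (density (v x)) * (vel_u (v x) * deriv (\<lambda>y. vel_w (v y)) x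
        - vel_w (v x) * deriv (\<lambda>y. vel_u (v y)) x)) (at_right 0)"
    by (intro tendsto_intros difference_quotient_tendsto_deriv[OF u]
        difference_quotient_tendsto_deriv[OF w])
  \<comment> \<open>The products \<open>a * b\<close> cancel, which turns the alternating expression
    into difference quotients. For \<open>h = 0\<close> both sides are 0, so the rewriting needs no
    side condition.\<close>
  moreover have "m * (a * ((b' - b) / h) - b * ((a' - a) / h)) = m * (a * b' - b * a') / h"
    for m a b a' b' h :: real
    by (simp add: right_diff_distrib diff_divide_distrib)
  ultimately show ?thesis
    by (simp add: capillary_flux_def)
qed

lemma consistent_full_flux_capillary:
  assumes \<G>0: "consistent_state_flux (entropy_flux0 P F) \<G>0"
    and r: "interface_density r"
    and \<kappa>: "smooth_on {0<..} \<kappa>"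
  shows "consistent_full_flux (entropy_flux P F \<kappa>) (\<lambda>\<delta>x V. \<G>0 V - capillary_flux \<kappa> r V / \<delta>x)"
  unfolding consistent_full_flux_def
proof (intro conjI allI impI)
  obtain S where S: "finite S" "\<And>V W. V \<in> admissible \<Longrightarrow> W \<in> admissible \<Longrightarrow>
      (\<forall>k\<in>S. V k = W k) \<Longrightarrow> \<G>0 V = \<G>0 W"
    using \<G>0 unfolding consistent_state_flux_def finite_stencil_def by blast
  obtain T where T: "finite T" "\<And>V W. (\<forall>k. V k > 0) \<Longrightarrow> (\<forall>k. W k > 0) \<Longrightarrow>
      (\<forall>k\<in>T. V k = W k) \<Longrightarrow> r V = r W"
    using r unfolding interface_density_def finite_stencil_def Ball_def mem_Collect_eq by metis
  \<comment> \<open>\<open>S\<close> serves \<open>\<G>0\<close>, \<open>T\<close> serves the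
    interface density, and \<open>{0, 1}\<close> the velocities in \<open>capillary_flux\<close>.
    None of them depends on \<open>\<delta>x\<close>.\<close>
  have "\<G>0 V - capillary_flux \<kappa> r V / \<delta>x = \<G>0 W - capillary_flux \<kappa> r W / \<delta>x"
    if "V \<in> admissible" "W \<in> admissible" "\<forall>k \<in> S \<union> T \<union> {0, 1}. V k = W k" for V W \<delta>x
  proof -
    have "\<G>0 V = \<G>0 W" using that by (intro S(2)) auto
    moreover have "r (\<lambda>k. density (V k)) = r (\<lambda>k. density (W k))"
      using that by (intro T(2)) (auto simp: admissible_def)
    ultimately show ?thesis using that(3) by (simp add: capillary_flux_def)
  qed
  then show "\<exists>S. finite S \<and> (\<forall>\<delta>x>0. \<forall>V\<in>admissible. \<forall>W\<in>admissible. (\<forall>k\<in>S. V k = W k) \<longrightarrow>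
      \<G>0 V - capillary_flux \<kappa> r V / \<delta>x = \<G>0 W - capillary_flux \<kappa> r W / \<delta>x)"
    using S(1) T(1) by (intro exI[of _ "S \<union> T \<union> {0, 1}"]) blast
next
  fix v :: "real \<Rightarrow> state" and x :: real
  assume v: "(\<forall>i. smooth_on UNIV (\<lambda>x. v x $ i)) \<and> (\<forall>x. density (v x) > 0)"
  have cont: "continuous_on UNIV v"
  proof -
    have "isCont (\<lambda>y. v y $ i) y" for i y
      using smooth_on_imp_differentiable[of UNIV "\<lambda>y. v y $ i" y] v
      by (simp add: differentiable_imp_continuous_within)
    then have "continuous_on UNIV (\<lambda>y. \<chi> i. v y $ i)"
      by (intro continuous_on_vec_lambda) (simp add: continuous_on_eq_continuous_at)
    then show ?thesis by simp
  qed
  have "((\<lambda>h. \<G>0 (\<lambda>k. v (x + of_int k * h))) \<longlongrightarrow> \<G>0 (\<lambda>_. v x)) (at_right 0)"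
    using \<G>0 v unfolding consistent_state_flux_def
    by (intro grid_sampling_tendsto[OF _ cont, where A = admissible]) (auto simp: admissible_def)
  then have "((\<lambda>h. \<G>0 (\<lambda>k. v (x + of_int k * h))) \<longlongrightarrow> entropy_flux0 P F (v x)) (at_right 0)"
    using \<G>0 v unfolding consistent_state_flux_def by simp
  then show "((\<lambda>h. \<G>0 (\<lambda>k. v (x + of_int k * h))
        - capillary_flux \<kappa> r (\<lambda>k. v (x + of_int k * h)) / h) \<longlongrightarrow>
      entropy_flux P F \<kappa> (v x) (deriv (\<lambda>y. vel_u (v y)) x) (deriv (\<lambda>y. vel_w (v y)) x)) (at_right 0)"
    unfolding entropy_flux_def using v
    by (intro tendsto_diff capillary_flux_tendsto[OF r \<kappa>]) auto
qed

lemma inner_rhs_EK: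
  assumes F: "smooth_on {0<..} F" and V: "V \<in> admissible"
  shows "gradient (entropy F) (V j) \<bullet> rhs_EK F \<kappa> r fnum \<delta>x V j =
    gradient (entropy F) (V j) \<bullet> rhs_H fnum \<delta>x V j
    + (capillary_flux \<kappa> r (recentre j V) - capillary_flux \<kappa> r (recentre (j - 1) V)) / \<delta>x\<^sup>2"
proof -
  have z: "entropy_var F (V i) $ 2 = vel_u (V i)" "entropy_var F (V i) $ 3 = vel_w (V i)" for i
    using V entropy_var_components[OF smooth_on_imp_differentiable[OF F]]
    by (simp_all add: admissible_def)
  show ?thesis
    \<comment> \<open>By \<open>inner_Bmat\<close> the terms pairing \<open>z j\<close> with itself
      drop out. At the left interface \<open>z j\<close> is paired with \<open>z (j - 1)\<close>;
      swapping the two gives minus the capillary flux recentred at \<open>j - 1\<close>.\<close>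
    unfolding entropy_var_def[symmetric] rhs_EK_def rhs_H_def Let_def inner_add_right
      inner_scaleR_right inner_diff_right[of _ "Bmat _ _ *v _"] inner_Bmat
      vector_minus_component z
    by (simp add: capillary_flux_def recentre_def algebra_simps diff_divide_distrib add_divide_distrib)
qed

theorem proposition3p1:
  fixes P F \<kappa> :: "real \<Rightarrow> real"
    and fnum :: "(int \<Rightarrow> state) \<Rightarrow> state"
    and r :: "(int \<Rightarrow> real) \<Rightarrow> real"
  assumes P_smooth: "smooth_on {0<..} P"
    and P_deriv_pos: "\<And>\<rho>. \<rho> > 0 \<Longrightarrow> deriv P \<rho> > 0"
    and F_smooth: "smooth_on {0<..} F"
    and F_P: "\<And>\<rho>. \<rho> > 0 \<Longrightarrow> \<rho> * deriv F \<rho> - F \<rho> = P \<rho>"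
    and \<kappa>_smooth: "smooth_on {0<..} \<kappa>"
    and \<kappa>_pos: "\<And>\<rho>. \<rho> > 0 \<Longrightarrow> \<kappa> \<rho> > 0"
    and fnum: "consistent_state_flux (flux P) fnum"
    and r: "interface_density r"
    and H_stable: "\<exists>\<G>0. consistent_state_flux (entropy_flux0 P F) \<G>0 \<and>
                     entropy_inequality F (rhs_H fnum) (\<lambda>_. \<G>0)"
  shows "\<exists>\<G>. consistent_full_flux (entropy_flux P F \<kappa>) \<G> \<and>
             entropy_inequality F (rhs_EK F \<kappa> r fnum) \<G>"
proof -
  obtain \<G>0 where \<G>0: "consistent_state_flux (entropy_flux0 P F) \<G>0"
    and H: "entropy_inequality F (rhs_H fnum) (\<lambda>_. \<G>0)"
    using H_stable by blast
  define \<G> where "\<G> \<delta>x V = \<G>0 V - capillary_flux \<kappa> r V / \<delta>x" for \<delta>x V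
  \<comment> \<open>The difference of capillary fluxes over \<open>\<delta>x\<^sup>2\<close> from
    the scheme cancels against the correction in \<open>\<G>\<close>, divided once in its definition
    and once in the flux difference. Entropy production is thus the same for both schemes.\<close>
  have "gradient (entropy F) (V j) \<bullet> rhs_EK F \<kappa> r fnum \<delta>x V j
      + (\<G> \<delta>x (recentre j V) - \<G> \<delta>x (recentre (j - 1) V)) / \<delta>x
    = gradient (entropy F) (V j) \<bullet> rhs_H fnum \<delta>x V j
      + (\<G>0 (recentre j V) - \<G>0 (recentre (j - 1) V)) / \<delta>x"
    if "V \<in> admissible" for V j \<delta>x
    unfolding inner_rhs_EK[OF F_smooth that] \<G>_def
    by (simp add: diff_divide_distrib power2_eq_square)
  then have "entropy_inequality F (rhs_EK F \<kappa> r fnum) \<G>"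
    using H unfolding entropy_inequality_def by simp
  moreover have "consistent_full_flux (entropy_flux P F \<kappa>) \<G>"
    using consistent_full_flux_capillary[OF \<G>0 r \<kappa>_smooth] unfolding \<G>_def .
  ultimately show ?thesis by blast
qed

end
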